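(* For all integers $0\leq k\leq n$, \[ S_1[n,k] = (-1)^{n-k} \sum_{j=0}^{n-k} (-1)^j \binom{n-1+j}{n-k+j} \binom{2n-k}{n-k-j} S_2[n-k+j,j]. \]
   Context: Let $q$ be an indeterminate. For $n\geq 0$ let $\mathfrak{S}_n$ be the set of permutations of $\{1,\dots,n\}$. For $\sigma\in\mathfrak{S}_n$, a right-to-left maximum is an index $i$ such that $\sigma(i)>\sigma(j)$ for all $j$ with $i<j\leq n$; let $\mathrm{rlm}(\sigma)$ be their number. An inversion of $\sigma$ is a pair $(i,j)$ with $1\leq i<j\leq n$ and $\sigma(i)>\sigma(j)$; it is special if there exists $k'$ with $j<k'\leq n$ and $\sigma(i)<\sigma(k')$. Let $\mathrm{inv}'(\sigma)$ be the number of special inversions. For $0\leq k\leq n$, define $S_1[n,k]=\sum_{\sigma} q^{\mathrm{inv}'(\sigma)}$, summed over $\sigma\in\mathfrak{S}_n$ with $\mathrm{rlm}(\sigma)=k$. For a set partition $\pi$ of $\{1,\dots,n\}$, draw an arc $(b_t,b_{t+1})$ for each pair of consecutive elements $b_t<b_{t+1}$ of each block $\{b_1<\dots<b_m\}$. A crossing is a pair of arcs $(a,c),(b,d)$ with $a<b<c<d$; let $\mathrm{cro}(\pi)$ be the number of crossings. For $0\leq k\leq n$, define $S_2[n,k]=\sum_\pi q^{\mathrm{cro}(\pi)}$, summed over set partitions $\pi$ of $\{1,\dots,n\}$ into exactly $k$ blocks (so $S_2[0,0]=1$). *)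

theory Defs
  imports
    "HOL-Combinatorics.Permutations"
    "HOL-Library.Disjoint_Sets"
    "HOL-Computational_Algebra.Polynomial"
begin

definition rlm :: "nat \<Rightarrow> (nat \<Rightarrow> nat) \<Rightarrow> nat" where
  "rlm n \<sigma> = card {i \<in> {1..n}. \<forall>j. i < j \<and> j \<le> n \<longrightarrow> \<sigma> i > \<sigma> j}"

text \<open>
  The number of special inversions: inversions (i, j) for which some value to the right of
  position j exceeds the value at position i.
\<close>

definition inv' :: "nat \<Rightarrow> (nat \<Rightarrow> nat) \<Rightarrow> nat" where
  "inv' n \<sigma> = card {(i, j). 1 \<le> i \<and> i < j \<and> j \<le> n \<and> \<sigma> i > \<sigma> j \<and>
                       (\<exists>k'. j < k' \<and> k' \<le> n \<and> \<sigma> i < \<sigma> k')}"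

text \<open>The indeterminate q is the variable of the polynomial ring over the integers.\<close>

definition S1 :: "nat \<Rightarrow> nat \<Rightarrow> int poly" where
  "S1 n k = (\<Sum>\<sigma> | \<sigma> permutes {1..n} \<and> rlm n \<sigma> = k. monom 1 (inv' n \<sigma>))"

definition arcs :: "nat set set \<Rightarrow> (nat \<times> nat) set" where
  "arcs \<pi> = {(a, c). \<exists>B\<in>\<pi>. a \<in> B \<and> c \<in> B \<and> a < c \<and> (\<forall>b\<in>B. \<not> (a < b \<and> b < c))}"

definition cro :: "nat set set \<Rightarrow> nat" where
  "cro \<pi> = card {((a, c), (b, d)). (a, c) \<in> arcs \<pi> \<and> (b, d) \<in> arcs \<pi> \<and> a < b \<and> b < c \<and> c < d}"

definition S2 :: "nat \<Rightarrow> nat \<Rightarrow> int poly" where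
  "S2 n k = (\<Sum>\<pi> | partition_on {1..n} \<pi> \<and> card \<pi> = k. monom 1 (cro \<pi>))"

end

theory Submission
  imports Defs "HOL-Computational_Algebra.Formal_Power_Series"
begin

text \<open>
  Write \<open>m = n - k\<close>. Building a set partition element by element, with the number of open arcs as
  state, gives \<open>S2 (m + x) x = (I + T)^(m + x)\<close> at the entry "\<open>m\<close> arcs, none open" for a nilpotent
  transfer operator \<open>T\<close>. Building a permutation from right to left, with the number of skipped values
  as state, yields the same recursion run backwards, so that \<open>S1 n k\<close> is the same entry of
  \<open>(I + T)^(- k)\<close>. Expanding in powers of \<open>T\<close>, the polynomial \<open>R x = S2 (m + x) x\<close> is a combination
  of \<open>(m + x) choose i\<close> with \<open>m \<le> i \<le> 2 m\<close>, and \<open>S1 n k = R (- n)\<close>. Hence \<open>R x\<close> divided by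
  \<open>(m + x) choose m\<close> has degree at most \<open>m\<close>, and the theorem is its Lagrange interpolation from the
  values at \<open>0, \<dots>, m\<close>.
\<close>

subsection \<open>The transfer operator\<close>

text \<open>The q-analogue of \<open>n\<close>; since it is 0 at 0, terms with the factor
  \<open>qint h\<close> may be written for \<open>h = 0\<close> too.\<close>

definition qint :: "nat \<Rightarrow> int poly" where
  "qint n = (\<Sum>i<n. monom 1 i)"

text \<open>
  \<open>step_coeff i\<close> is the \<open>i\<close>-th power of the transfer operator, applied to the initial state:
  \<open>h\<close> counts open arcs and \<open>d\<close> closed arcs, and a step closes an arc, opens one, or does both.
\<close>

fun step_coeff :: "nat \<Rightarrow> nat \<Rightarrow> nat \<Rightarrow> int poly" where
  "step_coeff 0 h d = (if h = 0 \<and> d = 0 then 1 else 0)"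
| "step_coeff (Suc i) h d = (if h > 0 then step_coeff i (h - 1) d else 0) +
     (if d > 0 then qint (h + 1) * step_coeff i (h + 1) (d - 1) + qint h * step_coeff i h (d - 1) else 0)"

text \<open>Every step raises \<open>h + 2 * d\<close> by one or two. This is the nilpotency that
  lets sums over powers stop at a bound \<open>B\<close>.\<close>

lemma step_coeff_eq_0_large: "h + 2 * d < i \<Longrightarrow> step_coeff i h d = 0"
  by (induction i arbitrary: h d) auto

text \<open>A step closes at most one arc.\<close>

lemma step_coeff_eq_0_small: "i < d \<Longrightarrow> step_coeff i h d = 0"
  by (induction i arbitrary: h d) auto

text \<open>The recursion makes \<open>W n\<close> the image of the initial state under
  \<open>(I + T)^n\<close>, and \<open>step_coeff i\<close> is its image under \<open>T^i\<close>.
  So this is the binomial theorem, cut off at \<open>B\<close>.\<close>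

lemma forward_recursion:
  fixes W :: "nat \<Rightarrow> nat \<Rightarrow> nat \<Rightarrow> int poly"
  assumes W0: "\<And>h d. W 0 h d = (if h = 0 \<and> d = 0 then 1 else 0)"
    and WSuc: "\<And>n h d. W (Suc n) h d = W n h d + (if h > 0 then W n (h - 1) d else 0) +
      (if d > 0 then qint (h + 1) * W n (h + 1) (d - 1) + qint h * W n h (d - 1) else 0)"
    and "h + 2 * d \<le> B"
  shows "W n h d = (\<Sum>i\<le>B. of_nat (n choose i) * step_coeff i h d)"
  using assms(3)
proof (induction n arbitrary: h d)
  case 0
  have "(\<Sum>i\<le>B. of_nat (0 choose i) * step_coeff i h d) = (\<Sum>i\<in>{0}. of_nat (0 choose i) * step_coeff i h d)"
    by (rule sum.mono_neutral_right) (auto simp: binomial_eq_0)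
  then show ?case by (simp add: W0)
next
  case (Suc n)
  let ?S = "\<lambda>f. \<Sum>i\<le>B. of_nat (n choose i) * f i"
  have "W (Suc n) h d = ?S (\<lambda>i. step_coeff i h d) + (if h > 0 then ?S (\<lambda>i. step_coeff i (h - 1) d) else 0) +
      (if d > 0 then qint (h + 1) * ?S (\<lambda>i. step_coeff i (h + 1) (d - 1)) +
         qint h * ?S (\<lambda>i. step_coeff i h (d - 1)) else 0)"
    using Suc.prems by (simp add: WSuc Suc.IH)
  also have "\<dots> = ?S (\<lambda>i. step_coeff i h d) + ?S (\<lambda>i. step_coeff (Suc i) h d)"
    by (simp add: algebra_simps sum.distrib sum_distrib_left)
  \<comment> \<open>The summand \<open>i = B\<close> drops out because \<open>B + 1\<close> steps
    lead beyond \<open>h + 2 * d \<le> B\<close>. Pascal's rule then merges the two sums.\<close>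
  also have "?S (\<lambda>i. step_coeff (Suc i) h d) = (\<Sum>i<B. of_nat (n choose i) * step_coeff (Suc i) h d)"
    using Suc.prems by (simp add: lessThan_Suc_atMost[symmetric] step_coeff_eq_0_large del: step_coeff.simps)
  also have "?S (\<lambda>i. step_coeff i h d) + \<dots> =
      step_coeff 0 h d + (\<Sum>i<B. of_nat (Suc n choose Suc i) * step_coeff (Suc i) h d)"
    by (simp add: sum.atMost_shift algebra_simps sum.distrib del: step_coeff.simps)
  also have "\<dots> = (\<Sum>i\<le>B. of_nat (Suc n choose i) * step_coeff i h d)"
    by (simp add: sum.atMost_shift del: step_coeff.simps binomial_Suc_Suc)
  finally show ?case .
qed

text \<open>Write \<open>I + T = (I + O) (I + C)\<close>, where \<open>C\<close> closes and
  \<open>O\<close> opens an arc. Up to the sign \<open>(-1) ^ h\<close>, prefix sums over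
  \<open>h\<close> invert \<open>I + O\<close>, so the recursion takes \<open>V l\<close> to
  \<open>V (Suc l)\<close> by the inverse of \<open>I + T\<close>. The claim is the binomial series
  of \<open>(I + T)^(-l)\<close>.\<close>

lemma backward_recursion:
  fixes V :: "nat \<Rightarrow> nat \<Rightarrow> nat \<Rightarrow> int poly"
  assumes V0: "\<And>h d. V 0 h d = (if h = 0 \<and> d = 0 then 1 else 0)"
    and VSuc: "\<And>l h d. V (Suc l) h d = (\<Sum>h'\<le>h. V l h' d) +
      (if d > 0 then qint (h + 1) * V (Suc l) (h + 1) (d - 1) else 0)"
    and "h + 2 * d \<le> B"
  shows "V l h d = (-1) ^ h * (\<Sum>i\<le>B. (-1) ^ i * of_nat ((l + i - 1) choose i) * step_coeff i h d)"
proof -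
  \<comment> \<open>\<open>b l i\<close> is the binomial coefficient of \<open>- l\<close> over
    \<open>i\<close>. Truncated subtraction gives the right values at \<open>l = 0\<close>: 1 for
    \<open>i = 0\<close> and 0 for \<open>i > 0\<close>.\<close>
  define b where "b l i = (-1) ^ i * (of_nat ((l + i - 1) choose i) :: int poly)" for l i :: nat
  define S where "S l f = (\<Sum>i\<le>B. b l i * f i)" for l and f :: "nat \<Rightarrow> int poly"
  define X where "X l h d = (-1) ^ h * S l (\<lambda>i. step_coeff i h d)" for l h d
  have b_Suc: "b (Suc l) (Suc i) - b l (Suc i) = - b (Suc l) i" for l i
    by (simp add: b_def algebra_simps)
  have b0: "b l 0 = 1" for l by (simp add: b_def)
  \<comment> \<open>In operator form:
    \<open>(I + T)^(-l-1) - (I + T)^(-l) = - T (I + T)^(-l-1)\<close>.\<close>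
  have S_diff: "S (Suc l) (\<lambda>i. step_coeff i h d) - S l (\<lambda>i. step_coeff i h d)
      = - S (Suc l) (\<lambda>i. step_coeff (Suc i) h d)" if "h + 2 * d \<le> B" for l h d
  proof -
    have "S (Suc l) (\<lambda>i. step_coeff i h d) - S l (\<lambda>i. step_coeff i h d)
       = (\<Sum>i<B. (b (Suc l) (Suc i) - b l (Suc i)) * step_coeff (Suc i) h d)"
      by (simp add: S_def sum.atMost_shift b0 left_diff_distrib sum_subtractf del: step_coeff.simps)
    also have "\<dots> = - (\<Sum>i<B. b (Suc l) i * step_coeff (Suc i) h d)"
      by (simp add: b_Suc sum_negf del: step_coeff.simps)
    also have "(\<Sum>i<B. b (Suc l) i * step_coeff (Suc i) h d) = S (Suc l) (\<lambda>i. step_coeff (Suc i) h d)"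
      using that by (simp add: S_def lessThan_Suc_atMost[symmetric] step_coeff_eq_0_large del: step_coeff.simps)
    finally show ?thesis .
  qed
  have S_step: "S l (\<lambda>i. step_coeff (Suc i) h d) = (if h > 0 then S l (\<lambda>i. step_coeff i (h - 1) d) else 0) +
      (if d > 0 then qint (h + 1) * S l (\<lambda>i. step_coeff i (h + 1) (d - 1)) +
         qint h * S l (\<lambda>i. step_coeff i h (d - 1)) else 0)" for l h d
    by (simp add: S_def algebra_simps sum.distrib sum_distrib_left)
  \<comment> \<open>\<open>D\<close> closes an arc; taken at \<open>h\<close> instead of
    \<open>Suc h\<close>, it also yields the term that closes and opens at once.\<close>
  define D where "D Y h d = (if d > 0 then qint (h + 1) * Y (h + 1) (d - 1) else 0)"
    for Y :: "nat \<Rightarrow> nat \<Rightarrow> int poly" and h d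
  have X_0: "X (Suc l) 0 d = X l 0 d + D (X (Suc l)) 0 d" if "2 * d \<le> B" for l d
    using S_diff[of 0 d l] that unfolding S_step X_def D_def
    by (auto simp: qint_def algebra_simps split: if_splits)
  have X_Suc: "X (Suc l) (Suc h) d = X l (Suc h) d + X (Suc l) h d - D (X (Suc l)) h d + D (X (Suc l)) (Suc h) d"
    if "Suc h + 2 * d \<le> B" for l h d
    using arg_cong[OF S_diff[of "Suc h" d l], of "\<lambda>t. (-1) ^ h * t"] that unfolding S_step X_def D_def
    by (auto simp: algebra_simps)
  have V_0: "V (Suc l) 0 d = V l 0 d + D (V (Suc l)) 0 d" for l d
    by (simp add: VSuc D_def)
  \<comment> \<open>Subtracting the recursion at \<open>h\<close> from the one at
    \<open>Suc h\<close> leaves a single term of the prefix sums.\<close>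
  have V_Suc: "V (Suc l) (Suc h) d = V l (Suc h) d + V (Suc l) h d - D (V (Suc l)) h d + D (V (Suc l)) (Suc h) d"
    for l h d
    unfolding VSuc[of l "Suc h" d] VSuc[of l h d] D_def by simp
  \<comment> \<open>\<open>V\<close> and \<open>X\<close> now obey the same recursion. It refers to
    a smaller \<open>l\<close>, or to the same \<open>l\<close> with smaller \<open>d\<close>, or to
    the same \<open>l\<close> and \<open>d\<close> with smaller \<open>h\<close>; hence three nested
    inductions. Passing from \<open>(h, d)\<close> to \<open>(h + 1, d - 1)\<close> respects the
    bound \<open>B\<close>.\<close>
  have "V l h d = X l h d" if "h + 2 * d \<le> B" for l h d
    using that
  proof (induction l arbitrary: h d)
    case 0
    have "S 0 (\<lambda>i. step_coeff i h d) = (\<Sum>i\<in>{0}. b 0 i * step_coeff i h d)"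
      unfolding S_def by (rule sum.mono_neutral_right) (auto simp: b_def binomial_eq_0)
    then show ?case by (simp add: X_def V0 b0)
  next
    case (Suc l)
    note IHl = Suc.IH
    from Suc.prems show ?case
    proof (induction d arbitrary: h)
      case 0
      then show ?case
      proof (induction h)
        case 0
        then show ?case by (simp add: V_0 X_0 IHl D_def)
      next
        case (Suc h)
        then show ?case by (simp add: V_Suc X_Suc IHl D_def)
      qed
    next
      case (Suc d)
      have D_eq: "D (V (Suc l)) h (Suc d) = D (X (Suc l)) h (Suc d)" if "h + 2 * Suc d \<le> B" for h
        using Suc.IH[of "h + 1"] that by (simp add: D_def)
      from Suc.prems show ?case
      proof (induction h)
        case 0
        then show ?case by (simp add: V_0 X_0 IHl D_eq)
      next
        case (Suc h)
        then show ?case by (simp add: V_Suc X_Suc IHl D_eq)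
      qed
    qed
  qed
  from this[OF assms(3)] show ?thesis by (simp add: X_def S_def b_def)
qed

subsection \<open>Binomial identities\<close>

text \<open>Vandermonde convolution for the upper arguments \<open>- N\<close> and
  \<open>N + r\<close>, which add up to \<open>r\<close>: the total is
  \<open>r choose r\<close>.\<close>

lemma alternating_Vandermonde:
  assumes "N > 0"
  shows "(\<Sum>t\<le>r. (-1) ^ t * int ((N + t - 1) choose t) * int ((N + r) choose (r - t))) = 1"
proof -
  have neg: "(- rat_of_nat N) gchoose t = (-1) ^ t * of_nat ((N + t - 1) choose t)" for t
    using assms by (simp add: gbinomial_minus binomial_gbinomial of_nat_diff)
  have "(1::rat) = (- of_nat N + of_nat (N + r)) gchoose r"
    by (simp add: gbinomial_binomial flip: binomial_gbinomial)
  also have "\<dots> = (\<Sum>t\<le>r. (-1) ^ t * of_nat ((N + t - 1) choose t) * of_nat ((N + r) choose (r - t)))"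
    unfolding gbinomial_Vandermonde[symmetric] atMost_atLeast0 neg
    by (simp only: binomial_gbinomial)
  also have "\<dots> = of_int (\<Sum>t\<le>r. (-1) ^ t * int ((N + t - 1) choose t) * int ((N + r) choose (r - t)))"
    by simp
  finally show ?thesis by linarith
qed

text \<open>Both sides are the multinomial coefficient with lower entries \<open>i\<close>,
  \<open>m + j - i\<close> and \<open>k - 1\<close>. On the right the first factor is free of
  \<open>j\<close> and can leave a sum over \<open>j\<close>.\<close>

lemma choose_mult_choose:
  assumes "k > 0" "m \<le> i" "i \<le> m + j"
  shows "((m + k + j - 1) choose (m + j)) * ((m + j) choose i)
    = ((k + i - 1) choose i) * ((m + k + j - 1) choose (m + j - i))"
proof -
  have "((m + k + j - 1) choose (m + j)) * ((m + j) choose i)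
      = ((m + k + j - 1) choose i) * ((m + k + j - 1 - i) choose (m + j - i))"
    using assms by (intro choose_mult) auto
  also have "(m + k + j - 1) choose i = (m + k + j - 1) choose (m + k + j - 1 - i)"
    using assms by (intro binomial_symmetric) auto
  also have "\<dots> * ((m + k + j - 1 - i) choose (m + j - i))
      = ((m + k + j - 1) choose (m + j - i)) * ((m + k + j - 1 - (m + j - i)) choose (m + k + j - 1 - i - (m + j - i)))"
    using assms by (intro choose_mult) auto
  also have "(m + k + j - 1 - (m + j - i)) choose (m + k + j - 1 - i - (m + j - i)) = (k + i - 1) choose (k + i - 1 - i)"
    using assms by (intro arg_cong2[where f = "(choose)"]) auto
  also have "\<dots> = (k + i - 1) choose i"
    using assms by (intro binomial_symmetric[symmetric]) auto
  finally show ?thesis by (simp add: mult.commute)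
qed

text \<open>
  Lagrange interpolation at \<open>0, \<dots>, m\<close>, evaluated at \<open>- n\<close> with \<open>n = m + k\<close>, of the polynomial
  \<open>((m + x) choose i) / ((m + x) choose m)\<close>, whose degree in \<open>x\<close> is \<open>i - m \<le> m\<close>.
\<close>

lemma interpolation:
  assumes "k > 0" "m \<le> i" "i \<le> 2 * m"
  shows "(-1) ^ m * (\<Sum>j\<le>m. (-1) ^ j * int ((m + k + j - 1) choose (m + j)) *
       int ((m + k + m) choose (m - j)) * int ((m + j) choose i)) = (-1) ^ i * int ((k + i - 1) choose i)"
proof -
  \<comment> \<open>\<open>s\<close> is the degree of the interpolated polynomial. Nodes
    \<open>j < s\<close> contribute nothing, since there \<open>m + j < i\<close>.\<close>
  define s where "s = i - m"
  have s: "s \<le> m" "i = m + s" using assms by (auto simp: s_def)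
  let ?K = "int ((k + i - 1) choose i)"
  let ?f = "\<lambda>j. (-1) ^ j * int ((m + k + j - 1) choose (m + j)) *
       int ((m + k + m) choose (m - j)) * int ((m + j) choose i)"
  have "(\<Sum>j\<le>m. ?f j) = (\<Sum>j\<in>{s..m}. ?f j)"
    by (rule sum.mono_neutral_right) (auto simp: s binomial_eq_0)
  also have "\<dots> = (\<Sum>t\<le>m - s. ?f (t + s))"
    by (rule sum.reindex_bij_witness[of _ "\<lambda>t. t + s" "\<lambda>j. j - s"]) (use s in auto)
  \<comment> \<open>Once the factor free of \<open>j\<close> is extracted,
    \<open>alternating_Vandermonde\<close> remains with \<open>N = m + k + s\<close> and
    \<open>r = m - s\<close>.\<close>
  also have "\<dots> = (\<Sum>t\<le>m - s. (-1) ^ s * ?K * ((-1) ^ t * int (((m + k + s) + t - 1) choose t) *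
       int (((m + k + s) + (m - s)) choose (m - s - t))))"
  proof (rule sum.cong)
    fix t assume "t \<in> {..m - s}"
    then have t: "t + s \<le> m" using s by auto
    have "int ((m + k + (t + s) - 1) choose (m + (t + s))) * int ((m + (t + s)) choose i)
        = ?K * int ((m + k + s + t - 1) choose t)"
      using choose_mult_choose[OF assms(1,2), of "t + s"] s
      by (simp add: add_ac flip: of_nat_mult)
    moreover have "m + k + s + (m - s) = m + k + m" "m - s - t = m - (t + s)" using s by auto
    moreover have "?f (t + s) = (-1) ^ (t + s) * int ((m + k + m) choose (m - (t + s))) *
        (int ((m + k + (t + s) - 1) choose (m + (t + s))) * int ((m + (t + s)) choose i))"
      by (simp only: mult_ac)
    ultimately show "?f (t + s) = (-1) ^ s * ?K * ((-1) ^ t * int (((m + k + s) + t - 1) choose t) *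
       int (((m + k + s) + (m - s)) choose (m - s - t)))"
      by (simp only: power_add mult_ac)
  qed auto
  also have "\<dots> = (-1) ^ s * ?K"
    unfolding sum_distrib_left[symmetric] using assms(1) by (subst alternating_Vandermonde) auto
  finally show ?thesis using s by (simp add: power_add)
qed

subsection \<open>Permutations\<close>

text \<open>The exponents are \<open>0, ..., card S - 1\<close>, each once: a new minimum adds the
  next one and leaves the others alone. It serves both models, for the choice of a missing value and
  of a half-open arc.\<close>

lemma sum_monom_rank:
  fixes S :: "nat set"
  assumes "finite S"
  shows "(\<Sum>x\<in>S. monom 1 (card {y \<in> S. x < y})) = qint (card S)"
  using assms
proof (induction S rule: finite_linorder_min_induct)
  case empty
  then show ?case by (simp add: qint_def)
next
  case (insert b A)
  have b: "b \<notin> A" using insert by auto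
  have "{y \<in> insert b A. b < y} = A" using insert by auto
  moreover have "{y \<in> insert b A. x < y} = {y \<in> A. x < y}" if "x \<in> A" for x using insert that by auto
  ultimately show ?case using insert b by (simp add: qint_def)
qed

section \<open>Suffix words and their recursion\<close>

fun rtl_maxima :: "nat list \<Rightarrow> nat" where
  "rtl_maxima [] = 0"
| "rtl_maxima (x # w) = rtl_maxima w + (if \<forall>y\<in>set w. y < x then 1 else 0)"

fun max_list :: "nat list \<Rightarrow> nat" where
  "max_list [] = 0"
| "max_list (x # w) = max x (max_list w)"

fun special_inv :: "nat list \<Rightarrow> nat" where
  "special_inv [] = 0"
| "special_inv (x # w) = special_inv w + card {b. x < b \<and> b < max_list w \<and> b \<notin> set w}"

text \<open>
  A word is read as a suffix of a permutation, still to be extended to the left;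
  \<open>h\<close> counts the values below its maximum that do not occur yet, and \<open>special_inv\<close>
  charges each letter with the larger missing values below the maximum, all of which end up to its left.
\<close>

definition words :: "nat \<Rightarrow> nat \<Rightarrow> nat \<Rightarrow> nat list set" where
  "words l h d = {w. distinct w \<and> 0 \<notin> set w \<and> rtl_maxima w = l \<and> length w = l + d \<and> max_list w = length w + h}"

definition missing :: "nat list \<Rightarrow> nat set" where
  "missing w = {1..max_list w} - set w"

lemma less_max_list_iff: "b < max_list w \<longleftrightarrow> (\<exists>y\<in>set w. b < y)"
  by (induction w) (auto simp: less_max_iff_disj)

lemma rtl_maxima_le_length: "rtl_maxima w \<le> length w"
  by (induction w) auto

lemma finite_missing: "finite (missing w)"
  by (simp add: missing_def)

lemma le_max_list: "y \<in> set w \<Longrightarrow> y \<le> max_list w"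
  by (induction w) (auto simp: le_max_iff_disj)

lemma max_list_in_set: "w \<noteq> [] \<Longrightarrow> max_list w \<in> set w"
proof (induction w)
  case (Cons x w)
  then show ?case by (cases "w = []") (auto simp: max_def)
qed simp

lemma card_missing:
  assumes "distinct w" "0 \<notin> set w"
  shows "card (missing w) = max_list w - length w"
proof -
  have "set w \<subseteq> {1..max_list w}" using assms by (auto simp: le_max_list Suc_le_eq intro: gr0I)
  then show ?thesis using assms by (simp add: missing_def card_Diff_subset distinct_card)
qed

lemma special_inv_Cons_missing:
  "x \<in> missing w \<Longrightarrow> special_inv (x # w) = special_inv w + card {b \<in> missing w. x < b}"
proof -
  assume "x \<in> missing w"
  then have "w \<noteq> []" by (auto simp: missing_def)
  then have "max_list w \<in> set w" by (rule max_list_in_set)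
  then have "{b. x < b \<and> b < max_list w \<and> b \<notin> set w} = {b \<in> missing w. x < b}"
    by (auto simp: missing_def order.order_iff_strict)
  then show ?thesis by simp
qed

lemma special_inv_Cons_large: "max_list w < x \<Longrightarrow> special_inv (x # w) = special_inv w"
proof -
  assume "max_list w < x"
  then have "{b. x < b \<and> b < max_list w \<and> b \<notin> set w} = {}" by auto
  then show ?thesis by simp
qed

lemma finite_words: "finite (words l h d)"
proof (rule finite_subset)
  show "words l h d \<subseteq> {w. set w \<subseteq> {..l + d + h} \<and> length w = l + d}"
    by (auto simp: words_def dest: le_max_list)
qed (simp add: finite_lists_length_eq)

lemma rtl_maxima_eq_0_iff: "rtl_maxima w = 0 \<longleftrightarrow> w = []"
proof (induction w)
  case (Cons x w)
  then show ?case by (cases w) auto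
qed auto

definition word_sum :: "nat \<Rightarrow> nat \<Rightarrow> nat \<Rightarrow> int poly" where
  "word_sum l h d = (\<Sum>w\<in>words l h d. monom 1 (special_inv w))"

lemma words_0: "words 0 h d = (if h = 0 \<and> d = 0 then {[]} else {})"
  by (auto simp: words_def rtl_maxima_eq_0_iff)

text \<open>Split off the first letter. If it exceeds the rest, it is a new right-to-left maximum
  whose value is forced by the length and \<open>h\<close>, and the rest may miss any
  \<open>h' \<le> h\<close> values. Otherwise it fills a gap, so the rest has one gap more and one
  non-maximum less.\<close>

lemma words_Suc:
  "words (Suc l) h d = (#) (Suc l + d + h) ` (\<Union>h'\<le>h. words l h' d) \<union>
     (if d > 0 then (\<lambda>(w, x). x # w) ` Sigma (words (Suc l) (h + 1) (d - 1)) missing else {})"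
  (is "?L = ?A \<union> ?B")
proof (rule set_eqI)
  fix v
  show "v \<in> ?L \<longleftrightarrow> v \<in> ?A \<union> ?B"
  proof (cases v)
    case Nil
    then show ?thesis by (auto simp: words_def)
  next
    case (Cons x w)
    have len: "length w \<le> max_list w" if "distinct w" "0 \<notin> set w"
    proof -
      have "set w \<subseteq> {1..max_list w}" using that by (auto simp: le_max_list Suc_le_eq intro: gr0I)
      then show ?thesis using card_mono[of "{1..max_list w}" "set w"] that by (simp add: distinct_card)
    qed
    \<comment> \<open>A zero or a repeated letter occurs on neither side; the second and fourth
      cases match the two parts of the union.\<close>
    consider "x = 0" | "x > 0" "max_list w < x" | "x > 0" "x \<in> set w" | "x \<le> max_list w" "x \<notin> set w" "x > 0"
      by linarith
    then show ?thesis
    proof cases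
      case 1
      then show ?thesis by (auto simp: words_def Cons missing_def)
    next
      case 2
      then have "x \<notin> set w" "\<forall>y\<in>set w. y < x" "x \<notin> missing w"
        using le_max_list[of _ w] by (fastforce simp: missing_def)+
      moreover from this have "v \<in> ?L \<longleftrightarrow> distinct w \<and> 0 \<notin> set w \<and> rtl_maxima w = l \<and> length w = l + d \<and> x = Suc l + d + h"
        using 2 by (auto simp: words_def Cons)
      ultimately show ?thesis using 2 len by (auto simp: words_def Cons image_iff intro!: bexI[of _ "max_list w - length w"])
    next
      case 3
      then show ?thesis using le_max_list[of x w] by (auto simp: words_def Cons missing_def)
    next
      case 4
      then have "\<not> (\<forall>y\<in>set w. y < x)" "x \<in> missing w" "w \<noteq> []" using max_list_in_set[of w]
        by (force simp: missing_def)+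
      then show ?thesis using 4 rtl_maxima_le_length[of w] by (auto simp: words_def Cons max_def rtl_maxima_eq_0_iff)
    qed
  qed
qed

lemma word_sum_0: "word_sum 0 h d = (if h = 0 \<and> d = 0 then 1 else 0)"
  by (simp add: word_sum_def words_0)

text \<open>A new maximum costs nothing, while a filled gap pays for the larger gaps; by
  \<open>sum_monom_rank\<close> the choice among \<open>h + 1\<close> gaps yields
  \<open>qint (h + 1)\<close>.\<close>

lemma word_sum_Suc:
  "word_sum (Suc l) h d = (\<Sum>h'\<le>h. word_sum l h' d) +
     (if d > 0 then qint (h + 1) * word_sum (Suc l) (h + 1) (d - 1) else 0)"
proof -
  let ?A = "\<Union>h'\<le>h. words l h' d" and ?x = "Suc l + d + h"
  let ?B = "Sigma (words (Suc l) (h + 1) (d - 1)) missing"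
  let ?f = "\<lambda>w. monom 1 (special_inv w) :: int poly"
  have A: "(\<Sum>w\<in>(#) ?x ` ?A. ?f w) = (\<Sum>h'\<le>h. word_sum l h' d)"
  proof -
    have "(\<Sum>w\<in>(#) ?x ` ?A. ?f w) = (\<Sum>w\<in>?A. ?f w)"
      by (subst sum.reindex) (auto intro!: sum.cong simp: words_def special_inv_Cons_large simp del: special_inv.simps)
    also have "\<dots> = (\<Sum>h'\<le>h. word_sum l h' d)"
      unfolding word_sum_def by (rule sum.UNION_disjoint) (auto simp: finite_words, auto simp: words_def)
    finally show ?thesis .
  qed
  have B: "(\<Sum>w\<in>(\<lambda>(w, x). x # w) ` ?B. ?f w) = qint (h + 1) * word_sum (Suc l) (h + 1) (d - 1)"
  proof -
    have "(\<Sum>w\<in>(\<lambda>(w, x). x # w) ` ?B. ?f w) = (\<Sum>(w, x)\<in>?B. ?f (x # w))"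
      by (subst sum.reindex) (auto intro!: inj_onI sum.cong)
    also have "\<dots> = (\<Sum>w\<in>words (Suc l) (h + 1) (d - 1). \<Sum>x\<in>missing w. ?f (x # w))"
      by (rule sum.Sigma[symmetric]) (auto simp: finite_words missing_def)
    also have "\<dots> = (\<Sum>w\<in>words (Suc l) (h + 1) (d - 1). ?f w * qint (h + 1))"
    proof (rule sum.cong)
      fix w assume w: "w \<in> words (Suc l) (h + 1) (d - 1)"
      have "(\<Sum>x\<in>missing w. ?f (x # w)) = (\<Sum>x\<in>missing w. ?f w * monom 1 (card {b \<in> missing w. x < b}))"
        by (intro sum.cong) (auto simp: special_inv_Cons_missing mult_monom simp del: special_inv.simps)
      also have "\<dots> = ?f w * qint (card (missing w))"
        using sum_monom_rank[of "missing w"] by (simp add: finite_missing flip: sum_distrib_left)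
      also have "card (missing w) = h + 1" using w by (simp add: words_def card_missing)
      finally show "(\<Sum>x\<in>missing w. ?f (x # w)) = ?f w * qint (h + 1)" .
    qed auto
    finally show ?thesis by (simp add: word_sum_def sum_distrib_left mult.commute)
  qed
  have "((#) ?x ` ?A) \<inter> ((\<lambda>(w, x). x # w) ` ?B) = {}"
    by (auto simp: words_def missing_def)
  moreover have "finite ?A" "finite ?B"
    by (auto simp: finite_words missing_def)
  moreover have "word_sum (Suc l) h d = (\<Sum>w\<in>(#) ?x ` ?A \<union> (if d > 0 then (\<lambda>(w, x). x # w) ` ?B else {}). ?f w)"
    unfolding word_sum_def by (subst words_Suc) (rule refl)
  ultimately show ?thesis
    by (simp only: A[symmetric] B[symmetric] split: if_split) (auto simp: sum.union_disjoint)
qed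

section \<open>From permutations to words\<close>

lemma rtl_maxima_map:
  "i \<le> Suc n \<Longrightarrow> rtl_maxima (map \<sigma> [i..<Suc n]) = card {j \<in> {i..n}. \<forall>k. j < k \<and> k \<le> n \<longrightarrow> \<sigma> j > \<sigma> k}"
proof (induction rule: inc_induct)
  case base
  then show ?case by simp
next
  case (step i)
  let ?P = "\<lambda>j. \<forall>k. j < k \<and> k \<le> n \<longrightarrow> \<sigma> j > \<sigma> k"
  have "{j \<in> {i..n}. ?P j} = (if ?P i then {i} else {}) \<union> {j \<in> {Suc i..n}. ?P j}"
    using step.hyps by (auto simp: le_eq_less_or_eq Suc_le_eq)
  moreover have "card \<dots> = (if ?P i then 1 else 0) + card {j \<in> {Suc i..n}. ?P j}"
    by (subst card_Un_disjoint) auto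
  moreover have "(\<forall>y\<in>set (map \<sigma> [Suc i..<Suc n]). y < \<sigma> i) \<longleftrightarrow> ?P i"
    by (auto simp: Suc_le_eq less_Suc_eq_le)
  ultimately show ?case using step
    by (simp only: upt_conv_Cons list.map rtl_maxima.simps)
qed

lemma special_inv_map:
  "i \<le> Suc n \<Longrightarrow> special_inv (map \<sigma> [i..<Suc n]) =
    (\<Sum>j = i..n. card {b. \<sigma> j < b \<and> (\<exists>k. j < k \<and> k \<le> n \<and> b < \<sigma> k) \<and> b \<notin> \<sigma> ` {Suc j..n}})"
proof (induction rule: inc_induct)
  case base
  then show ?case by simp
next
  case (step i)
  have "set (map \<sigma> [Suc i..<Suc n]) = \<sigma> ` {Suc i..n}" by auto
  moreover have "b < max_list (map \<sigma> [Suc i..<Suc n]) \<longleftrightarrow> (\<exists>k. i < k \<and> k \<le> n \<and> b < \<sigma> k)" for b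
    by (auto simp: less_max_list_iff Suc_le_eq less_Suc_eq_le)
  ultimately show ?case using step
    by (simp only: upt_conv_Cons list.map special_inv.simps sum.atLeast_Suc_atMost[of i] less_Suc_eq_le)
qed

text \<open>Group special inversions by their right position \<open>j\<close>. Then
  \<open>\<sigma>\<close> carries the left positions bijectively to the values above
  \<open>\<sigma> j\<close> that are absent from the suffix after \<open>j\<close> but below its
  maximum: such a value is at most \<open>n\<close>, hence attained, and only to the left of
  \<open>j\<close>.\<close>

lemma inv'_eq_special_inv:
  assumes "\<sigma> permutes {1..n}"
  shows "inv' n \<sigma> = special_inv (map \<sigma> [1..<Suc n])"
proof -
  let ?I = "\<lambda>j. {i. 1 \<le> i \<and> i < j \<and> \<sigma> i > \<sigma> j \<and> (\<exists>k. j < k \<and> k \<le> n \<and> \<sigma> i < \<sigma> k)}"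
  let ?J = "\<lambda>j. {b. \<sigma> j < b \<and> (\<exists>k. j < k \<and> k \<le> n \<and> b < \<sigma> k) \<and> b \<notin> \<sigma> ` {Suc j..n}}"
  have inj: "inj \<sigma>" using assms by (rule permutes_inj)
  have "inv' n \<sigma> = card ((\<lambda>(j, i). (i, j)) ` Sigma {1..n} ?I)"
    unfolding inv'_def by (rule arg_cong[of _ _ card]) auto
  also have "\<dots> = card (Sigma {1..n} ?I)"
    by (rule card_image) (auto intro!: inj_onI)
  also have "\<dots> = (\<Sum>j = 1..n. card (?I j))"
    by (rule card_SigmaI) (auto intro: finite_subset[of _ "{1..n}"])
  also have "\<dots> = (\<Sum>j = 1..n. card (?J j))"
  proof (rule sum.cong)
    fix j assume j: "j \<in> {1..n}"
    have "?J j \<subseteq> \<sigma> ` ?I j"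
    proof
      fix b assume b: "b \<in> ?J j"
      then obtain k where k: "j < k" "k \<le> n" "b < \<sigma> k" by auto
      then have "\<sigma> k \<in> {1..n}" using permutes_in_image[OF assms, of k] by auto
      then have "b \<in> {1..n}" using b k by auto
      then obtain i where i: "i \<in> {1..n}" "b = \<sigma> i" using permutes_image[OF assms] by blast
      then have "i \<notin> {Suc j..n}" "i \<noteq> j" using b by auto
      then show "b \<in> \<sigma> ` ?I j" using i b by auto
    qed
    moreover have "\<sigma> i \<notin> \<sigma> ` {Suc j..n}" if "i < j" for i
      using that by (auto simp: inj_image_mem_iff[OF inj])
    then have "\<sigma> ` ?I j \<subseteq> ?J j" by (intro image_subsetI) simp
    ultimately have "?J j = \<sigma> ` ?I j" by blast
    then show "card (?I j) = card (?J j)" using inj by (simp add: card_image inj_on_subset)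
  qed auto
  finally show ?thesis by (subst special_inv_map) simp_all
qed

text \<open>For \<open>h = 0\<close> a word has \<open>n\<close> distinct positive letters and
  maximum \<open>n\<close>, so it is the one-line notation of a permutation.\<close>

lemma S1_eq_word_sum:
  assumes "k \<le> n"
  shows "S1 n k = word_sum k 0 (n - k)"
proof -
  let ?P = "{\<sigma>. \<sigma> permutes {1..n} \<and> rlm n \<sigma> = k}" and ?f = "\<lambda>\<sigma>. map \<sigma> [1..<Suc n]"
  have rtl_maxima: "rtl_maxima (?f \<sigma>) = rlm n \<sigma>" for \<sigma>
    using rtl_maxima_map[of 1 n \<sigma>] by (simp add: rlm_def)
  have set_f: "set (?f \<sigma>) = {1..n}" if "\<sigma> permutes {1..n}" for \<sigma>
    using permutes_image[OF that] by (simp only: set_map set_upt atLeastLessThanSuc_atLeastAtMost)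
  have set_eq: "set w = {1..n}" if "w \<in> words k 0 (n - k)" for w
  proof (rule card_subset_eq)
    show "set w \<subseteq> {1..n}"
    proof
      fix x assume "x \<in> set w"
      moreover from this have "x \<le> n" using that assms le_max_list[of x w] by (simp add: words_def)
      moreover have "0 \<notin> set w" using that by (simp add: words_def)
      ultimately have "x \<noteq> 0" "x \<le> n" by metis+
      then show "x \<in> {1..n}" by simp
    qed
    show "card (set w) = card {1..n}" using that assms by (auto simp: words_def distinct_card)
  qed simp
  have max_list_eq: "max_list w = n" if "set w = {1..n}" for w
  proof (cases "w = []")
    case False
    then have "max_list w \<in> {1..n}" using max_list_in_set[of w] that by simp
    moreover from this have "n \<le> max_list w" using that by (intro le_max_list) simp
    ultimately show ?thesis by simp
  qed (use that in auto)
  have "inj_on ?f ?P"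
  proof (rule inj_onI, rule ext)
    fix \<sigma> \<tau> i assume *: "\<sigma> \<in> ?P" "\<tau> \<in> ?P" "?f \<sigma> = ?f \<tau>"
    from *(3) have "\<forall>j\<in>{1..n}. \<sigma> j = \<tau> j"
      by (simp only: map_eq_conv set_upt atLeastLessThanSuc_atLeastAtMost)
    moreover have "\<sigma> i = i" "\<tau> i = i" if "i \<notin> {1..n}"
      using *(1,2) permutes_not_in[OF _ that] by blast+
    ultimately show "\<sigma> i = \<tau> i" by (cases "i \<in> {1..n}") simp_all
  qed
  moreover have "?f ` ?P = words k 0 (n - k)"
  proof (rule set_eqI, rule iffI)
    fix w assume "w \<in> ?f ` ?P"
    then obtain \<sigma> where s: "\<sigma> permutes {1..n}" "rlm n \<sigma> = k" "w = ?f \<sigma>" by auto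
    then have "set w = {1..n}" using set_f by blast
    moreover have "distinct w" using s permutes_inj_on[OF s(1)] by (auto simp: distinct_map)
    ultimately show "w \<in> words k 0 (n - k)" using s assms rtl_maxima[of \<sigma>] max_list_eq[of w]
      by (auto simp: words_def simp del: upt_Suc)
  next
    fix w assume w: "w \<in> words k 0 (n - k)"
    define \<sigma> where "\<sigma> i = (if i \<in> {1..n} then w ! (i - 1) else i)" for i
    have len: "length w = n" and dist: "distinct w" using w assms by (auto simp: words_def)
    have f: "?f \<sigma> = w" by (rule nth_equalityI) (auto simp: len \<sigma>_def simp del: upt_Suc)
    have "inj_on \<sigma> {1..n}" using dist by (auto simp: inj_on_def \<sigma>_def nth_eq_iff_index_eq len)
    moreover have "\<sigma> ` {1..n} = {1..n}"
      using arg_cong[OF f, of set] set_eq[OF w]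
      by (simp only: set_map set_upt atLeastLessThanSuc_atLeastAtMost)
    ultimately have "\<sigma> permutes {1..n}"
      by (intro bij_imp_permutes) (auto simp: bij_betw_def \<sigma>_def)
    moreover from w have "rlm n \<sigma> = k" unfolding rtl_maxima[symmetric] f by (simp add: words_def)
    ultimately show "w \<in> ?f ` ?P" using f by (metis (mono_tags, lifting) imageI mem_Collect_eq)
  qed
  ultimately have "(\<Sum>w\<in>words k 0 (n - k). monom 1 (special_inv w)) = (\<Sum>\<sigma>\<in>?P. monom (1 :: int) (special_inv (?f \<sigma>)))"
    by (metis (no_types, lifting) sum.reindex_cong)
  then show ?thesis by (simp add: S1_def word_sum_def inv'_eq_special_inv del: upt_Suc)
qed

subsection \<open>Set partitions\<close>

text \<open>The elements of \<open>M\<close> are starting points of half-open arcs ending at infinity.\<close>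

definition extended_crossings :: "(nat \<times> nat) set \<Rightarrow> nat set \<Rightarrow> nat" where
  "extended_crossings A M =
    (\<Sum>(a, c)\<in>A. card {(b, d) \<in> A. a < b \<and> b < c \<and> c < d} + card {b \<in> M. a < b \<and> b < c})"

text \<open>A half-open arc is crossed only by arcs ending beyond its start, and no arc ends beyond
  \<open>N\<close>.\<close>

lemma extended_crossings_insert_open:
  assumes "\<And>a c. (a, c) \<in> A \<Longrightarrow> c \<le> N"
  shows "extended_crossings A (insert N M) = extended_crossings A M"
  unfolding extended_crossings_def
proof (rule sum.cong, goal_cases)
  case (2 x)
  obtain a c where x: "x = (a, c)" by fastforce
  then have "{b \<in> insert N M. a < b \<and> b < c} = {b \<in> M. a < b \<and> b < c}"
    using assms[of a c] 2 by auto
  then show ?case by (simp add: x)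
qed auto

text \<open>Crossings of old arcs with the half-open arc at \<open>m\<close> persist as crossings of
  complete arcs. The new arc ends beyond all others, so it gains exactly the half-open arcs starting
  after \<open>m\<close>; two half-open arcs were not charged for each other before.\<close>

lemma extended_crossings_close:
  assumes A: "finite A" "\<And>a c. (a, c) \<in> A \<Longrightarrow> c < N" and M: "finite M" "\<And>b. b \<in> M \<Longrightarrow> b < N"
    and m: "m \<in> M"
  shows "extended_crossings (insert (m, N) A) (M - {m}) = extended_crossings A M + card {b \<in> M. m < b}"
proof -
  let ?c = "\<lambda>A a c. card {(b, d) \<in> A. a < b \<and> b < c \<and> c < d}"
  let ?o = "\<lambda>M a c. card {b \<in> M. a < b \<and> b < c}"
  have old: "?c (insert (m, N) A) a c + ?o (M - {m}) a c = ?c A a c + ?o M a c" if "(a, c) \<in> A" for a c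
  proof (cases "a < m \<and> m < c")
    case True
    have "{(b, d) \<in> insert (m, N) A. a < b \<and> b < c \<and> c < d} = insert (m, N) {(b, d) \<in> A. a < b \<and> b < c \<and> c < d}"
      using True A(2)[OF that] by auto
    moreover have "finite {(b, d) \<in> A. a < b \<and> b < c \<and> c < d}"
      by (rule finite_subset[OF _ A(1)]) auto
    moreover have "(m, N) \<notin> A" using A(2) by blast
    moreover have "{b \<in> M. a < b \<and> b < c} = insert m {b \<in> M - {m}. a < b \<and> b < c}"
      using True m by auto
    ultimately show ?thesis using M(1) by simp
  next
    case False
    then have "{(b, d) \<in> insert (m, N) A. a < b \<and> b < c \<and> c < d} = {(b, d) \<in> A. a < b \<and> b < c \<and> c < d}"
      "{b \<in> M - {m}. a < b \<and> b < c} = {b \<in> M. a < b \<and> b < c}"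
      by auto
    then show ?thesis by simp
  qed
  have "{(b, d) \<in> insert (m, N) A. m < b \<and> b < N \<and> N < d} = {}"
    using A(2) by fastforce
  moreover have "{b \<in> M - {m}. m < b \<and> b < N} = {b \<in> M. m < b}"
    using M(2) by auto
  ultimately have new: "?c (insert (m, N) A) m N + ?o (M - {m}) m N = card {b \<in> M. m < b}"
    by (simp only: card.empty add_0)
  have "(m, N) \<notin> A" using A(2) by blast
  then show ?thesis
    unfolding extended_crossings_def using A(1) new old by (auto intro!: sum.cong)
qed

section \<open>Arcs of blocks\<close>

definition block_arcs :: "nat set \<Rightarrow> (nat \<times> nat) set" where
  "block_arcs B = {(a, c). a \<in> B \<and> c \<in> B \<and> a < c \<and> (\<forall>b\<in>B. \<not> (a < b \<and> b < c))}"

lemma arcs_eq_Union: "arcs \<pi> = (\<Union>B\<in>\<pi>. block_arcs B)"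
  by (auto simp: arcs_def block_arcs_def)

lemma block_arcs_insert:
  assumes "finite B" "B \<noteq> {}" "\<And>b. b \<in> B \<Longrightarrow> b < N"
  shows "block_arcs (insert N B) = insert (Max B, N) (block_arcs B)"
proof -
  have Max: "a \<in> B \<and> (\<forall>b\<in>B. \<not> a < b) \<longleftrightarrow> a = Max B" for a
    using assms(1,2) by (auto simp: not_less eq_Max_iff)
  have N: "N \<notin> B" using assms(3) by blast
  have "(a, c) \<in> block_arcs (insert N B) \<longleftrightarrow> (a, c) \<in> insert (Max B, N) (block_arcs B)" for a c
  proof (cases "c = N")
    case True
    have "(a, c) \<in> block_arcs (insert N B) \<longleftrightarrow> a \<in> B \<and> (\<forall>b\<in>B. \<not> a < b)"
      using assms(3) by (auto simp: block_arcs_def True)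
    also have "\<dots> \<longleftrightarrow> (a, c) \<in> insert (Max B, N) (block_arcs B)"
      unfolding Max using N by (auto simp: True block_arcs_def)
    finally show ?thesis .
  next
    case False
    then have "(a, c) \<in> block_arcs (insert N B) \<longleftrightarrow> (a, c) \<in> block_arcs B"
      using assms(3) by (auto simp: block_arcs_def dest: less_asym)
    with False show ?thesis by simp
  qed
  then show ?thesis by (simp add: set_eq_iff split_paired_all)
qed

lemma arcs_insert_singleton: "arcs (insert {x} \<pi>) = arcs \<pi>"
  by (auto simp: arcs_eq_Union block_arcs_def)

lemma arcs_extend_block:
  assumes "B \<in> \<pi>" "finite B" "B \<noteq> {}" "\<And>b. b \<in> B \<Longrightarrow> b < N"
  shows "arcs (insert (insert N B) (\<pi> - {B})) = insert (Max B, N) (arcs \<pi>)"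
proof -
  have "arcs \<pi> = block_arcs B \<union> arcs (\<pi> - {B})"
    using assms(1) by (auto simp: arcs_eq_Union)
  moreover have "arcs (insert (insert N B) (\<pi> - {B})) = block_arcs (insert N B) \<union> arcs (\<pi> - {B})"
    by (auto simp: arcs_eq_Union)
  ultimately show ?thesis using assms by (simp add: block_arcs_insert)
qed

text \<open>
  The blocks in \<open>H\<close> are those that will be continued by elements beyond \<open>n\<close>;
  each of them carries a half-open arc starting at its maximum. The number of arcs is \<open>d\<close>.
\<close>

definition marked_partitions :: "nat \<Rightarrow> nat \<Rightarrow> nat \<Rightarrow> (nat set set \<times> nat set set) set" where
  "marked_partitions n h d = {(\<pi>, H). partition_on {1..n} \<pi> \<and> H \<subseteq> \<pi> \<and> card H = h \<and> card \<pi> + d = n}"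

definition mark_weight :: "nat set set \<times> nat set set \<Rightarrow> int poly" where
  "mark_weight = (\<lambda>(\<pi>, H). monom 1 (extended_crossings (arcs \<pi>) (Max ` H)))"

definition partition_sum :: "nat \<Rightarrow> nat \<Rightarrow> nat \<Rightarrow> int poly" where
  "partition_sum n h d = (\<Sum>x\<in>marked_partitions n h d. mark_weight x)"

text \<open>Intermediate stage of adding the element \<open>n\<close>: it may have closed an arc but
  opens none. It splits a step into closing and then opening.\<close>

definition last_unmarked :: "nat \<Rightarrow> nat \<Rightarrow> nat \<Rightarrow> (nat set set \<times> nat set set) set" where
  "last_unmarked n h d = {(\<pi>, H) \<in> marked_partitions n h d. \<forall>B\<in>H. n \<notin> B}"

lemma finite_marked_partitions: "finite (marked_partitions n h d)"
proof (rule finite_subset)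
  show "marked_partitions n h d \<subseteq> Pow (Pow {1..n}) \<times> Pow (Pow {1..n})"
    by (auto simp: marked_partitions_def partition_on_def)
qed simp

lemma finite_last_unmarked: "finite (last_unmarked n h d)"
  by (rule finite_subset[OF _ finite_marked_partitions[of n h d]]) (auto simp: last_unmarked_def)

section \<open>Blocks and operations on them\<close>

lemma block_props:
  fixes B :: "nat set"
  assumes "partition_on {1..n} \<pi>" "B \<in> \<pi>"
  shows "finite B" "B \<noteq> {}" "B \<subseteq> {1..n}" "Max B \<in> B"
proof -
  show B: "B \<subseteq> {1..n}" "B \<noteq> {}" using assms by (auto simp: partition_on_def)
  show "finite B" using finite_subset[OF B(1)] by simp
  with B(2) show "Max B \<in> B" by simp
qed

lemma block_unique:
  assumes "partition_on A \<pi>" "B \<in> \<pi>" "B' \<in> \<pi>" "x \<in> B" "x \<in> B'"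
  shows "B = B'"
  using assms by (auto simp: partition_on_def disjoint_def)

definition block_at :: "nat \<Rightarrow> nat set set \<Rightarrow> nat set" where
  "block_at x \<pi> = (THE B. B \<in> \<pi> \<and> x \<in> B)"

lemma block_at_eq:
  assumes "partition_on A \<pi>" "B \<in> \<pi>" "x \<in> B"
  shows "block_at x \<pi> = B"
  unfolding block_at_def by (rule the_equality) (use assms block_unique[OF assms(1)] in blast)+

lemma block_at:
  assumes "partition_on A \<pi>" "x \<in> A"
  shows "block_at x \<pi> \<in> \<pi> \<and> x \<in> block_at x \<pi>"
proof -
  have "x \<in> \<Union>\<pi>" using assms by (simp add: partition_on_def)
  then obtain B where B: "B \<in> \<pi>" "x \<in> B" by blast
  then show ?thesis using block_at_eq[OF assms(1) B] by simp
qed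

text \<open>Blocks are disjoint and contain their maxima. Hence marked blocks correspond to the
  starting points of half-open arcs.\<close>

lemma inj_on_Max_blocks:
  fixes \<pi> :: "nat set set"
  assumes "partition_on {1..n} \<pi>"
  shows "inj_on Max \<pi>"
proof (rule inj_onI)
  fix B C assume *: "B \<in> \<pi>" "C \<in> \<pi>" "Max B = Max C"
  show "B = C"
    using block_unique[OF assms *(1,2), of "Max B"] block_props(4)[OF assms *(1)]
      block_props(4)[OF assms *(2)] *(3) by simp
qed

lemma arcs_bound: "partition_on {1..n} \<pi> \<Longrightarrow> (a, c) \<in> arcs \<pi> \<Longrightarrow> a \<in> {1..n} \<and> c \<in> {1..n}"
  unfolding arcs_def by (auto simp: partition_on_def)

lemma finite_arcs:
  assumes "partition_on {1..n} \<pi>"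
  shows "finite (arcs \<pi>)"
proof (rule finite_subset)
  show "arcs \<pi> \<subseteq> {1..n} \<times> {1..n}"
  proof (rule subrelI)
    show "(a, c) \<in> {1..n} \<times> {1..n}" if "(a, c) \<in> arcs \<pi>" for a c
      using arcs_bound[OF assms that] by simp
  qed
qed simp

lemma partition_on_remove_block:
  assumes "partition_on A \<pi>" "B \<in> \<pi>"
  shows "partition_on (A - B) (\<pi> - {B})"
proof -
  have "disjnt B (\<Union>(\<pi> - {B}))"
    using block_unique[OF assms(1)] assms(2) by (fastforce simp: disjnt_iff)
  from partition_on_insert[OF this, of A] show ?thesis
    using assms by (simp add: insert_absorb)
qed

lemma partition_on_insert_singleton:
  assumes "partition_on A \<pi>" "x \<notin> A"
  shows "partition_on (insert x A) (insert {x} \<pi>)"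
proof -
  have "disjnt {x} (\<Union>\<pi>)" using assms by (simp add: partition_on_def)
  from partition_on_insert[OF this] show ?thesis using assms by simp
qed

lemma partition_on_extend_block:
  assumes "partition_on A \<pi>" "B \<in> \<pi>" "x \<notin> A"
  shows "partition_on (insert x A) (insert (insert x B) (\<pi> - {B}))"
proof -
  have p: "partition_on (A - B) (\<pi> - {B})" using assms by (intro partition_on_remove_block)
  have "disjnt (insert x B) (\<Union>(\<pi> - {B}))"
    unfolding partition_onD1[OF p, symmetric] using assms(3) by (auto simp: disjnt_iff)
  moreover have "insert x A - insert x B = A - B" "B \<subseteq> A"
    using assms by (auto simp: partition_on_def)
  ultimately show ?thesis using p by (subst partition_on_insert) auto
qed

lemma partition_on_shrink_block:
  assumes "partition_on (insert x A) \<pi>" "X \<in> \<pi>" "x \<in> X" "X \<noteq> {x}" "x \<notin> A"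
  shows "partition_on A (insert (X - {x}) (\<pi> - {X}))"
proof -
  have p: "partition_on (insert x A - X) (\<pi> - {X})" using assms by (intro partition_on_remove_block)
  have "disjnt (X - {x}) (\<Union>(\<pi> - {X}))"
    unfolding partition_onD1[OF p, symmetric] by (auto simp: disjnt_iff)
  moreover have "A - (X - {x}) = insert x A - X" using assms(3,5) by auto
  moreover have "X \<subseteq> insert x A" using assms(1,2) by (auto simp: partition_on_def)
  then have "X - {x} \<subseteq> A" by auto
  moreover have "X - {x} \<noteq> {}" using assms(3,4) by auto
  ultimately show ?thesis using p by (subst partition_on_insert) auto
qed

section \<open>Adding one element to a marked partition\<close>

text \<open>The opening half of a step. If the block of the new element is marked, unmarking it
  deletes the half-open arc starting there, which is free by
  \<open>extended_crossings_insert_open\<close>.\<close>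

lemma partition_sum_split:
  "partition_sum (Suc n) h d = (\<Sum>x\<in>last_unmarked (Suc n) h d. mark_weight x) +
     (if h > 0 then \<Sum>x\<in>last_unmarked (Suc n) (h - 1) d. mark_weight x else 0)"
proof -
  let ?N = "Suc n"
  let ?R = "{(\<pi>, H) \<in> marked_partitions ?N h d. \<exists>B\<in>H. ?N \<in> B}"
  let ?X = "block_at ?N"
  have X: "?X \<pi> \<in> \<pi>" "?N \<in> ?X \<pi>" if "partition_on {1..?N} \<pi>" for \<pi>
    using block_at[OF that, of ?N] by auto
  have X_eq: "B = ?X \<pi>" if "partition_on {1..?N} \<pi>" "B \<in> \<pi>" "?N \<in> B" for B \<pi>
    using block_at_eq[OF that] by simp
  have MaxX: "Max (?X \<pi>) = ?N" if p: "partition_on {1..?N} \<pi>" for \<pi>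
    using X[OF p] block_props[OF p, of "?X \<pi>"] by (intro Max_eqI) auto
  have fin: "finite H" if "partition_on {1..?N} \<pi>" "H \<subseteq> \<pi>" for \<pi> H
    using that finite_elements[of "{1..?N}" \<pi>] finite_subset by blast
  have "marked_partitions ?N h d = last_unmarked ?N h d \<union> ?R"
    by (auto simp: last_unmarked_def)
  then have "partition_sum ?N h d = (\<Sum>x\<in>last_unmarked ?N h d \<union> ?R. mark_weight x)"
    unfolding partition_sum_def by (rule arg_cong)
  also have "\<dots> = (\<Sum>x\<in>last_unmarked ?N h d. mark_weight x) + (\<Sum>x\<in>?R. mark_weight x)"
    by (rule sum.union_disjoint) (auto intro: finite_last_unmarked finite_subset[OF _ finite_marked_partitions[of ?N h d]] simp: last_unmarked_def)
  also have "(\<Sum>x\<in>?R. mark_weight x) =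
      (if h > 0 then \<Sum>x\<in>last_unmarked ?N (h - 1) d. mark_weight x else 0)"
  proof (cases "h > 0")
    case True
    have "(\<Sum>x\<in>?R. mark_weight x) = (\<Sum>x\<in>last_unmarked ?N (h - 1) d. mark_weight x)"
    proof (rule sum.reindex_bij_witness[of _ "\<lambda>(\<pi>, H). (\<pi>, insert (?X \<pi>) H)" "\<lambda>(\<pi>, H). (\<pi>, H - {?X \<pi>})"], goal_cases)
      case (1 x)
      then obtain \<pi> H B where x: "x = (\<pi>, H)" "partition_on {1..?N} \<pi>" "H \<subseteq> \<pi>" "B \<in> H" "?N \<in> B"
        by (auto simp: marked_partitions_def)
      then have "B = ?X \<pi>" using X_eq by blast
      then show ?case using x by (simp add: insert_absorb)
    next
      case (2 x)
      then obtain \<pi> H B where x: "x = (\<pi>, H)" "partition_on {1..?N} \<pi>" "H \<subseteq> \<pi>" "B \<in> H" "?N \<in> B"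
        "card H = h" "card \<pi> + d = ?N"
        by (auto simp: marked_partitions_def)
      then have B: "B = ?X \<pi>" using X_eq by blast
      have "\<forall>C\<in>H - {?X \<pi>}. ?N \<notin> C" using X_eq[OF x(2)] x(3) by blast
      moreover have "card (H - {?X \<pi>}) = h - 1" using x(4,6) B by simp
      ultimately show ?case using x(1,2,3,7) by (auto simp: marked_partitions_def last_unmarked_def)
    next
      case (3 x)
      then show ?case using X by (auto simp: marked_partitions_def last_unmarked_def)
    next
      case (4 x)
      then obtain \<pi> H where x: "x = (\<pi>, H)" "partition_on {1..?N} \<pi>" "H \<subseteq> \<pi>" "\<forall>B\<in>H. ?N \<notin> B"
        "card H = h - 1" "card \<pi> + d = ?N"
        by (auto simp: marked_partitions_def last_unmarked_def)
      note X = X[OF x(2)]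
      have "?X \<pi> \<notin> H" using X(2) x(4) by blast
      then have "card (insert (?X \<pi>) H) = h" using fin[OF x(2,3)] x(5) True by simp
      then show ?case using x X by (auto simp: marked_partitions_def)
    next
      case (5 x)
      then obtain \<pi> H B where x: "x = (\<pi>, H)" "partition_on {1..?N} \<pi>" "H \<subseteq> \<pi>" "B \<in> H" "?N \<in> B"
        by (auto simp: marked_partitions_def)
      then have B: "B = ?X \<pi>" using X_eq by blast
      have "Max ` H = Max ` insert (?X \<pi>) (H - {?X \<pi>})" using x(4) B by (simp add: insert_absorb)
      also have "\<dots> = insert ?N (Max ` (H - {?X \<pi>}))" by (simp only: image_insert MaxX[OF x(2)])
      finally have "Max ` H = insert ?N (Max ` (H - {?X \<pi>}))" .
      then show ?case using arcs_bound[OF x(2)]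
        by (simp add: x(1) mark_weight_def extended_crossings_insert_open)
    qed
    then show ?thesis using True by simp
  next
    case False
    then have "?R = {}" using fin by (fastforce simp: marked_partitions_def)
    then show ?thesis using False by (simp only: sum.empty if_False)
  qed
  finally show ?thesis .
qed

text \<open>The closing half of a step. The new element is a singleton block or ends the half-open
  arc of one of \<open>h + 1\<close> marked blocks, at the cost of the half-open arcs starting
  later; \<open>sum_monom_rank\<close> adds up these costs.\<close>

lemma last_unmarked_sum:
  "(\<Sum>x\<in>last_unmarked (Suc n) h d. mark_weight x) = partition_sum n h d +
     (if d > 0 then qint (h + 1) * partition_sum n (h + 1) (d - 1) else 0)"
proof -
  let ?N = "Suc n"
  let ?S = "{(\<pi>, H) \<in> last_unmarked ?N h d. {?N} \<in> \<pi>}"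
  let ?T = "{(\<pi>, H) \<in> last_unmarked ?N h d. {?N} \<notin> \<pi>}"
  have N: "{1..?N} = insert ?N {1..n}" "?N \<notin> {1..n}" by auto
  have notin: "?N \<notin> B" if "partition_on {1..n} \<pi>" "B \<in> \<pi>" for \<pi> B
    using block_props(3)[OF that] by auto
  have fin: "finite \<pi>" if "partition_on {1..m} \<pi>" for \<pi> :: "nat set set" and m
    using that finite_elements[of "{1..m}" \<pi>] by blast
  have "last_unmarked ?N h d = ?S \<union> ?T" by auto
  then have "(\<Sum>x\<in>last_unmarked ?N h d. mark_weight x) = (\<Sum>x\<in>?S \<union> ?T. mark_weight x)"
    by (rule arg_cong)
  also have "\<dots> = (\<Sum>x\<in>?S. mark_weight x) + (\<Sum>x\<in>?T. mark_weight x)"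
    by (rule sum.union_disjoint) (auto intro: finite_subset[OF _ finite_last_unmarked[of ?N h d]])
  also have "(\<Sum>x\<in>?S. mark_weight x) = partition_sum n h d"
    unfolding partition_sum_def
  proof (rule sum.reindex_bij_witness[of _ "\<lambda>(\<pi>, H). (insert {?N} \<pi>, H)" "\<lambda>(\<pi>, H). (\<pi> - {{?N}}, H)"], goal_cases)
    case (1 x)
    then show ?case by auto
  next
    case (2 x)
    then obtain \<pi> H where x: "x = (\<pi>, H)" "partition_on {1..?N} \<pi>" "H \<subseteq> \<pi>" "card H = h" "card \<pi> + d = ?N"
      "\<forall>B\<in>H. ?N \<notin> B" "{?N} \<in> \<pi>"
      by (auto simp: marked_partitions_def last_unmarked_def)
    have "{1..?N} - {?N} = {1..n}" by auto
    then have "partition_on {1..n} (\<pi> - {{?N}})"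
      using partition_on_remove_block[OF x(2,7)] by (simp only:)
    moreover have "card \<pi> = Suc (card (\<pi> - {{?N}}))" using card.remove[OF fin[OF x(2)] x(7)] .
    ultimately show ?case using x by (auto simp: marked_partitions_def)
  next
    case (3 x)
    then show ?case using notin by (auto simp: marked_partitions_def)
  next
    case (4 x)
    then obtain \<pi> H where x: "x = (\<pi>, H)" "partition_on {1..n} \<pi>" "H \<subseteq> \<pi>" "card H = h" "card \<pi> + d = n"
      by (auto simp: marked_partitions_def)
    have "partition_on {1..?N} (insert {?N} \<pi>)"
      using partition_on_insert_singleton[OF x(2) N(2)] by (simp only: N(1))
    moreover have "{?N} \<notin> \<pi>" using notin[OF x(2)] by blast
    ultimately show ?case using x notin fin[OF x(2)] by (auto simp: marked_partitions_def last_unmarked_def)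
  next
    case (5 x)
    then obtain \<pi> H where x: "x = (\<pi>, H)" "{?N} \<in> \<pi>" by auto
    then show ?case using arcs_insert_singleton[of ?N "\<pi> - {{?N}}"]
      by (simp add: mark_weight_def insert_absorb)
  qed
  also have "(\<Sum>x\<in>?T. mark_weight x) = (if d > 0 then qint (h + 1) * partition_sum n (h + 1) (d - 1) else 0)"
  proof (cases "d > 0")
    case True
    let ?P = "marked_partitions n (h + 1) (d - 1)"
    let ?w = "\<lambda>\<pi> H B. monom 1 (extended_crossings (arcs \<pi>) (Max ` H)) * monom 1 (card {b \<in> Max ` H. Max B < b}) :: int poly"
    let ?X = "block_at ?N"
    \<comment> \<open>The right side ranges over marked partitions of \<open>{1..n}\<close> with a
      selected marked block \<open>B\<close> to extend. Extension keeps the number of blocks while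
      the ground set grows, so \<open>d - 1\<close> becomes \<open>d\<close>.\<close>
    have "(\<Sum>x\<in>?T. mark_weight x) = (\<Sum>((\<pi>, H), B)\<in>Sigma ?P snd. ?w \<pi> H B)"
    proof (rule sum.reindex_bij_witness[of _
          "\<lambda>((\<pi>, H), B). (insert (insert ?N B) (\<pi> - {B}), H - {B})"
          "\<lambda>(\<pi>, H). ((insert (?X \<pi> - {?N}) (\<pi> - {?X \<pi>}), insert (?X \<pi> - {?N}) H), ?X \<pi> - {?N})"], goal_cases)
      case (1 x)
      then obtain \<pi> H where x: "x = (\<pi>, H)" "partition_on {1..?N} \<pi>" "H \<subseteq> \<pi>" "\<forall>B\<in>H. ?N \<notin> B" "{?N} \<notin> \<pi>"
        by (auto simp: marked_partitions_def last_unmarked_def)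
      have "?N \<in> \<Union>\<pi>" using x(2) by (auto simp: partition_on_def)
      then obtain B where B: "B \<in> \<pi>" "?N \<in> B" by blast
      have "?X \<pi> = B" using block_at_eq[OF x(2) B] .
      have "B \<noteq> {?N}" using B(1) x(5) by blast
      then have "B - {?N} \<noteq> {}" using B(2) by blast
      then have "B - {?N} \<notin> \<pi>" using block_unique[OF x(2) B(1), of "B - {?N}"] B by auto
      then show ?case using B x \<open>?X \<pi> = B\<close> by (auto simp: insert_absorb)
    next
      case (2 x)
      then obtain \<pi> H where x: "x = (\<pi>, H)" "partition_on {1..?N} \<pi>" "H \<subseteq> \<pi>" "\<forall>B\<in>H. ?N \<notin> B" "{?N} \<notin> \<pi>"
        and c: "card H = h" "card \<pi> + d = ?N"
        by (auto simp: marked_partitions_def last_unmarked_def)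
      have "?N \<in> \<Union>\<pi>" using x(2) by (auto simp: partition_on_def)
      then obtain B where B: "B \<in> \<pi>" "?N \<in> B" by blast
      have XB: "?X \<pi> = B" using block_at_eq[OF x(2) B] .
      have "B \<noteq> {?N}" using B(1) x(5) by blast
      then have "B - {?N} \<noteq> {}" using B(2) by blast
      \<comment> \<open>Blocks are disjoint, so the shrunken block cannot already be present; this
        keeps the block count unchanged.\<close>
      then have notin': "B - {?N} \<notin> \<pi>" using block_unique[OF x(2) B(1), of "B - {?N}"] B by auto
      have "partition_on {1..n} (insert (B - {?N}) (\<pi> - {B}))"
        using partition_on_shrink_block[OF _ B \<open>B \<noteq> {?N}\<close> N(2)] x(2) by (simp only: N(1))
      moreover have "card (insert (B - {?N}) (\<pi> - {B})) = card \<pi>"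
        using notin' fin[OF x(2)] B(1) card.remove[of \<pi> B] by simp
      moreover have "card (insert (B - {?N}) H) = h + 1"
        using notin' x(3) c(1) finite_subset[OF x(3) fin[OF x(2)]] by (subst card_insert_disjoint) auto
      ultimately show ?case using True x(3,4) c B by (auto simp: x(1) XB marked_partitions_def)
    next
      case (3 y)
      then obtain \<pi> H B where y: "y = ((\<pi>, H), B)" "partition_on {1..n} \<pi>" "H \<subseteq> \<pi>" "B \<in> H"
        by (auto simp: marked_partitions_def)
      then have B: "B \<in> \<pi>" "?N \<notin> B" using notin by auto
      have "partition_on {1..?N} (insert (insert ?N B) (\<pi> - {B}))"
        using partition_on_extend_block[OF y(2) B(1) N(2)] by (simp only: N(1))
      then have "?X (insert (insert ?N B) (\<pi> - {B})) = insert ?N B" by (rule block_at_eq) auto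
      moreover have "insert ?N B \<notin> \<pi>" using notin[OF y(2)] by blast
      ultimately show ?case using y B by (auto simp: insert_absorb)
    next
      case (4 y)
      obtain \<pi> H B where y1: "y = ((\<pi>, H), B)" by (metis surj_pair)
      then have y: "y = ((\<pi>, H), B)" "partition_on {1..n} \<pi>" "H \<subseteq> \<pi>" "B \<in> H"
        and c: "card H = h + 1" "card \<pi> + (d - 1) = n"
        using 4 by (simp_all add: marked_partitions_def)
      then have "B \<in> \<pi>" by blast
      note B = this block_props(2)[OF y(2) this]
      have "insert ?N B \<notin> \<pi>" using notin[OF y(2)] by blast
      then have "card (insert (insert ?N B) (\<pi> - {B})) = card \<pi>"
        using fin[OF y(2)] B(1) card.remove[of \<pi> B] by simp
      moreover have "partition_on {1..?N} (insert (insert ?N B) (\<pi> - {B}))"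
        using partition_on_extend_block[OF y(2) B(1) N(2)] by (simp only: N(1))
      moreover have "{?N} \<notin> \<pi>" "{?N} \<noteq> insert ?N B" using notin[OF y(2)] B by auto
      moreover have "card (H - {B}) = h" using c y(4) by simp
      moreover have "\<forall>C\<in>H - {B}. ?N \<notin> C" using notin[OF y(2)] y(3) by blast
      ultimately show ?case using c y True
        by (auto simp: marked_partitions_def last_unmarked_def)
    next
      case (5 x)
      then obtain \<pi> H where x: "x = (\<pi>, H)" "partition_on {1..?N} \<pi>" "H \<subseteq> \<pi>" "\<forall>B\<in>H. ?N \<notin> B" "{?N} \<notin> \<pi>"
        by (auto simp: marked_partitions_def last_unmarked_def)
      have "?N \<in> \<Union>\<pi>" using x(2) by (auto simp: partition_on_def)
      then obtain Y where Y: "Y \<in> \<pi>" "?N \<in> Y" by blast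
      have XY: "?X \<pi> = Y" using block_at_eq[OF x(2) Y] .
      define B where "B = Y - {?N}"
      define \<pi>' where "\<pi>' = insert B (\<pi> - {Y})"
      have "Y \<noteq> {?N}" using Y x(5) by blast
      have YB: "Y = insert ?N B" "B \<noteq> {}" using Y \<open>Y \<noteq> {?N}\<close> by (auto simp: B_def)
      then have "B \<notin> \<pi>" using block_unique[OF x(2) Y(1), of B] Y by (auto simp: B_def)
      then have \<pi>: "\<pi> = insert (insert ?N B) (\<pi>' - {B})" using Y YB by (auto simp: \<pi>'_def)
      have p': "partition_on {1..n} \<pi>'"
        using partition_on_shrink_block[OF _ Y \<open>Y \<noteq> {?N}\<close> N(2)] x(2) by (simp only: N(1) \<pi>'_def B_def)
      have B: "B \<in> \<pi>'" by (simp add: \<pi>'_def)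
      note Bp = block_props[OF p' B]
      have "H \<subseteq> \<pi>'" using x(3,4) Y by (auto simp: \<pi>'_def)
      then have inj: "inj_on Max (insert B H)"
        by (intro inj_on_subset[OF inj_on_Max_blocks[OF p']]) (use B in auto)
      have "B \<notin> H" using \<open>B \<notin> \<pi>\<close> x(3) by auto
      then have M: "Max ` H = Max ` insert B H - {Max B}" using inj by (auto simp: inj_on_def)
      have "arcs \<pi> = insert (Max B, ?N) (arcs \<pi>')"
        unfolding \<pi> using Bp by (intro arcs_extend_block[OF B]) auto
      moreover have "extended_crossings (insert (Max B, ?N) (arcs \<pi>')) (Max ` insert B H - {Max B}) =
          extended_crossings (arcs \<pi>') (Max ` insert B H) + card {b \<in> Max ` insert B H. Max B < b}"
      proof (rule extended_crossings_close)
        show "finite (arcs \<pi>')" using finite_arcs[OF p'] .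
        show "c < ?N" if "(a, c) \<in> arcs \<pi>'" for a c using arcs_bound[OF p' that] by auto
        show "finite (Max ` insert B H)" using \<open>H \<subseteq> \<pi>'\<close> fin[OF p'] by (auto intro: finite_subset)
        show "b < ?N" if "b \<in> Max ` insert B H" for b
        proof -
          have "b \<in> Max ` \<pi>'" using that \<open>H \<subseteq> \<pi>'\<close> B by blast
          then obtain C where "C \<in> \<pi>'" "b = Max C" by blast
          then show ?thesis using block_props[OF p', of C] by auto
        qed
      qed simp
      ultimately have "mark_weight x = ?w \<pi>' (insert B H) B"
        unfolding x(1) mark_weight_def by (simp only: prod.case M mult_monom) simp
      then show ?case by (simp add: x(1) \<pi>'_def B_def XY)
    qed
    also have "\<dots> = (\<Sum>x\<in>?P. \<Sum>B\<in>snd x. ?w (fst x) (snd x) B)"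
    proof -
      have "finite (snd x)" if "x \<in> ?P" for x
        using that by (auto simp: marked_partitions_def intro: card_ge_0_finite)
      then show ?thesis
        using sum.Sigma[of ?P snd "\<lambda>x B. ?w (fst x) (snd x) B"] finite_marked_partitions
        by (simp add: split_def)
    qed
    also have "\<dots> = (\<Sum>x\<in>?P. mark_weight x * qint (h + 1))"
    proof (rule sum.cong, goal_cases)
      case (2 x)
      then obtain \<pi> H where x: "x = (\<pi>, H)" "partition_on {1..n} \<pi>" "H \<subseteq> \<pi>" "card H = h + 1"
        by (auto simp: marked_partitions_def)
      have inj: "inj_on Max H" using inj_on_subset[OF inj_on_Max_blocks[OF x(2)] x(3)] .
      have "(\<Sum>B\<in>H. monom 1 (card {b \<in> Max ` H. Max B < b})) =
          (\<Sum>m\<in>Max ` H. monom (1 :: int) (card {b \<in> Max ` H. m < b}))"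
        by (simp add: sum.reindex[OF inj])
      also have "\<dots> = qint (card (Max ` H))"
        using x(4) card_ge_0_finite[of H] by (intro sum_monom_rank) simp
      also have "card (Max ` H) = h + 1" using inj x(4) by (simp add: card_image)
      finally show ?case by (simp add: x(1) mark_weight_def flip: sum_distrib_left)
    qed auto
    also have "\<dots> = qint (h + 1) * partition_sum n (h + 1) (d - 1)"
      by (simp add: partition_sum_def sum_distrib_left mult.commute)
    finally show ?thesis using True by simp
  next
    case False
    have "?T = {}"
    proof -
      have False if "(\<pi>, H) \<in> ?T" for \<pi> H
      proof -
        have p: "partition_on {1..?N} \<pi>" "card \<pi> = ?N" "{?N} \<notin> \<pi>"
          using that False by (auto simp: marked_partitions_def last_unmarked_def)
        have "?N \<in> \<Union>\<pi>" using p(1) by (auto simp: partition_on_def)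
        then obtain Y where Y: "Y \<in> \<pi>" "?N \<in> Y" by blast
        then have "Y \<noteq> {?N}" using p by blast
        \<comment> \<open>For \<open>d = 0\<close> there are \<open>?N\<close> blocks. Deleting
          \<open>?N\<close> from its block, not a singleton, keeps that number, but the distinct
          block maxima now lie in \<open>{1..n}\<close>.\<close>
        let ?Q = "insert (Y - {?N}) (\<pi> - {Y})"
        have q: "partition_on {1..n} ?Q"
          using partition_on_shrink_block[OF _ Y \<open>Y \<noteq> {?N}\<close> N(2)] p(1) by (simp only: N(1))
        have img: "Max ` ?Q \<subseteq> {1..n}"
          by (rule image_subsetI) (rule subsetD[OF block_props(3)[OF q] block_props(4)[OF q]])
        have "Y - {?N} \<noteq> {}" using Y(2) \<open>Y \<noteq> {?N}\<close> by blast
        then have "Y - {?N} \<notin> \<pi>" using block_unique[OF p(1) Y(1), of "Y - {?N}"] Y by auto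
        then have "card ?Q = Suc (card (\<pi> - {Y}))"
          using fin[OF p(1)] by (intro card_insert_disjoint) auto
        then have "card ?Q = ?N"
          by (simp only: card.remove[OF fin[OF p(1)] Y(1), symmetric] p(2))
        then show False using card_inj_on_le[OF inj_on_Max_blocks[OF q] img] by simp
      qed
      then have no_pair: "(\<pi>, H) \<notin> ?T" for \<pi> H by blast
      show ?thesis
      proof (rule equals0I)
        fix x assume "x \<in> ?T"
        moreover obtain \<pi> H where "x = (\<pi>, H)" by (rule prod.exhaust)
        ultimately show False using no_pair[of \<pi> H] by (simp only:)
      qed
    qed
    then show ?thesis using False by (simp only: sum.empty if_False)
  qed
  finally show ?thesis .
qed

lemma partition_sum_0: "partition_sum 0 h d = (if h = 0 \<and> d = 0 then 1 else 0)"
proof -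
  have "marked_partitions 0 h d = (if h = 0 \<and> d = 0 then {({}, {})} else {})"
    by (auto simp: marked_partitions_def partition_on_empty)
  then show ?thesis
    by (simp add: partition_sum_def mark_weight_def extended_crossings_def arcs_def)
qed

text \<open>Closing followed by opening: the factorisation of \<open>I + T\<close>, with
  \<open>qint 0 = 0\<close> covering \<open>h = 0\<close>.\<close>

lemma partition_sum_Suc:
  "partition_sum (Suc n) h d = partition_sum n h d + (if h > 0 then partition_sum n (h - 1) d else 0) +
    (if d > 0 then qint (h + 1) * partition_sum n (h + 1) (d - 1) + qint h * partition_sum n h (d - 1) else 0)"
  by (cases h) (simp_all add: partition_sum_split last_unmarked_sum qint_def)

text \<open>With no marked block there are no half-open arcs, and \<open>extended_crossings\<close>
  is \<open>cro\<close>.\<close>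

lemma S2_eq_partition_sum:
  assumes "k \<le> n"
  shows "S2 n k = partition_sum n 0 (n - k)"
proof -
  let ?P = "{\<pi>. partition_on {1..n} \<pi> \<and> card \<pi> = k}"
  have cro: "cro \<pi> = extended_crossings (arcs \<pi>) {}" if p: "partition_on {1..n} \<pi>" for \<pi>
  proof -
    let ?D = "\<lambda>(a, c). {(b, d) \<in> arcs \<pi>. a < b \<and> b < c \<and> c < d}"
    have "cro \<pi> = card (Sigma (arcs \<pi>) ?D)"
      unfolding cro_def by (rule arg_cong[of _ _ card]) auto
    also have "\<dots> = (\<Sum>x\<in>arcs \<pi>. card (?D x))"
      using finite_arcs[OF p] by (intro card_SigmaI) (auto intro: finite_subset)
    finally show ?thesis by (simp add: extended_crossings_def split_def)
  qed
  have "marked_partitions n 0 (n - k) = (\<lambda>\<pi>. (\<pi>, {})) ` ?P"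
    using assms finite_elements[of "{1..n}"]
    by (auto simp: marked_partitions_def card_eq_0_iff dest: finite_subset)
  then have "partition_sum n 0 (n - k) = (\<Sum>\<pi>\<in>?P. mark_weight (\<pi>, {}))"
    unfolding partition_sum_def by (simp add: sum.reindex inj_on_def)
  then show ?thesis by (simp add: S2_def mark_weight_def cro)
qed

subsection \<open>Reciprocity between the two kinds\<close>

theorem theorem6p1:
  fixes n k :: nat
  assumes "k \<le> n"
  shows "S1 n k = (-1) ^ (n - k) *
    (\<Sum>j = 0..n - k. (-1) ^ j * of_nat ((n + j - 1) choose (n - k + j)) *
        of_nat ((2 * n - k) choose (n - k - j)) * S2 (n - k + j) j)"
proof -
  define m where "m = n - k"
  have n: "n = m + k" "2 * n - k = m + k + m" using assms by (auto simp: m_def)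
  let ?c = "\<lambda>i. step_coeff i 0 m"
  let ?a = "\<lambda>j. (-1) ^ j * int ((m + k + j - 1) choose (m + j)) * int ((m + k + m) choose (m - j))"
  \<comment> \<open>Both recursions are read off at the state \<open>(0, m)\<close>, where
    \<open>h + 2 * d = 2 * m\<close> serves as the bound.\<close>
  have S1: "S1 n k = (\<Sum>i\<le>2 * m. of_int ((-1) ^ i * int ((k + i - 1) choose i)) * ?c i)"
    using backward_recursion[of word_sum 0 m "2 * m" k, OF word_sum_0 word_sum_Suc]
    by (simp add: S1_eq_word_sum[OF assms] m_def)
  have S2: "S2 (m + j) j = (\<Sum>i\<le>2 * m. of_nat ((m + j) choose i) * ?c i)" for j
    using forward_recursion[of partition_sum 0 m "2 * m" "m + j", OF partition_sum_0 partition_sum_Suc]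
    by (simp add: S2_eq_partition_sum)
  \<comment> \<open>Compare the coefficients of each \<open>?c i\<close>. For \<open>i < m\<close>
    the entry itself vanishes; otherwise \<open>interpolation\<close> applies when
    \<open>k > 0\<close>.\<close>
  have "of_int ((-1) ^ i * int ((k + i - 1) choose i)) * ?c i
      = of_int ((-1) ^ m * (\<Sum>j\<le>m. ?a j * int ((m + j) choose i))) * ?c i" if "i \<le> 2 * m" for i
  proof (cases "i < m")
    case True
    then show ?thesis by (simp add: step_coeff_eq_0_small)
  next
    case i: False
    show ?thesis
    proof (cases "k = 0")
      case True
      \<comment> \<open>For \<open>k = 0\<close> both sides vanish if \<open>m > 0\<close>. If
        \<open>m = 0\<close>, then \<open>i = 0\<close>, and truncated subtraction makes both
        coefficients 1.\<close>
      then show ?thesis using i that by (cases "m = 0") (auto simp: binomial_eq_0)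
    next
      case False
      then show ?thesis using i that interpolation[of k m i] by simp
    qed
  qed
  then have "S1 n k = (\<Sum>i\<le>2 * m. of_int ((-1) ^ m * (\<Sum>j\<le>m. ?a j * int ((m + j) choose i))) * ?c i)"
    unfolding S1 by (intro sum.cong) auto
  also have "\<dots> = (-1) ^ m * (\<Sum>i\<le>2 * m. \<Sum>j\<le>m. of_int (?a j) * (of_nat ((m + j) choose i) * ?c i))"
    by (simp add: sum_distrib_left sum_distrib_right mult.assoc)
  also have "\<dots> = (-1) ^ m * (\<Sum>j\<le>m. of_int (?a j) * S2 (m + j) j)"
    unfolding S2 sum_distrib_left[of "of_int _"] by (subst sum.swap) (rule refl)
  finally show ?thesis
    by (simp only: n(2) m_def[symmetric]) (simp add: n(1) atMost_atLeast0)
qed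

end
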